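(* For the class $\mathcal{S}_p$ of parabolic starlike functions, the following hold: (i) $R_{\mathcal{S}_{p}}(\mathcal{G}_1)= \sqrt{37}-6\approx 0.0827$; (ii) $R_{\mathcal{S}_{p}}(\mathcal{G}_2)\geq (2\sqrt{7}-5)/3\approx 0.0972$; (iii) $R_{\mathcal{S}_{p}}(\mathcal{G}_3)= \sqrt{17}-4\approx 0.1231$.
   Context: $\mathbb{D}$ is the open unit disc in $\mathbb{C}$. $\mathcal{A}$ is the class of analytic functions $f$ on $\mathbb{D}$ with $f(0)=0$, $f'(0)=1$. $\mathcal{P}$ is the class of analytic functions $p$ on $\mathbb{D}$ with $p(0)=1$ and $\operatorname{Re}p(z)>0$ for all $z\in\mathbb{D}$; $\mathcal{P}(1/2)=\{p\in\mathcal{P}:\operatorname{Re}p(z)>1/2 \text{ for all } z\in\mathbb{D}\}$. Quotients below are understood with removable singularities filled in (in particular at $0$). Define $\mathcal{G}_1=\{f\in\mathcal{A}: f/g\in\mathcal{P}\text{ and } g/(zp)\in\mathcal{P}\text{ for some } g\in\mathcal{A},\ p\in\mathcal{P}\}$, $\mathcal{G}_2=\{f\in\mathcal{A}: f/g\in\mathcal{P}\text{ and } g/(zp)\in\mathcal{P}(1/2)\text{ for some } g\in\mathcal{A},\ p\in\mathcal{P}\}$, $\mathcal{G}_3=\{f\in\mathcal{A}: f/(zp)\in\mathcal{P}\text{ for some } p\in\mathcal{P}\}$. For subclasses $\mathcal{F},\mathcal{G}$ of $\mathcal{A}$, the $\mathcal{G}$-radius $R_{\mathcal{G}}(\mathcal{F})$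 of $\mathcal{F}$ is the largest number $R\in(0,1)$ such that, for every $f\in\mathcal{F}$ and every $0<r<R$, the function $z\mapsto r^{-1}f(rz)$ belongs to $\mathcal{G}$. For analytic $f,g$ on $\mathbb{D}$, $f\prec g$ ($f$ is subordinate to $g$) means $f=g\circ w$ for some analytic $w:\mathbb{D}\to\mathbb{D}$ with $w(0)=0$. For an analytic univalent $\varphi$ on $\mathbb{D}$ with $\varphi(0)=1$, $\mathcal{S}^*(\varphi)=\{f\in\mathcal{A}: zf'(z)/f(z)\prec\varphi(z)\}$. $\mathcal{S}_p=\mathcal{S}^*(\varphi_{PAR})$ with $\varphi_{PAR}(z)=1+\frac{2}{\pi^2}\left(\log\frac{1+\sqrt{z}}{1-\sqrt{z}}\right)^2$, which maps $\mathbb{D}$ onto the parabolic region $\{w:\operatorname{Re}w>|w-1|\}$. *)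

theory Defs
  imports "HOL-Complex_Analysis.Complex_Analysis"
begin

abbreviation unit_disc :: "complex set" ("\<bbbD>")
  where "\<bbbD> \<equiv> ball 0 1"

text \<open>
  Functions on the disc are total functions of type \<open>complex \<Rightarrow> complex\<close>; all the notions
  below depend only on their values on \<open>\<bbbD>\<close>.
\<close>

definition class_A :: "(complex \<Rightarrow> complex) set" where
  "class_A = {f. f holomorphic_on \<bbbD> \<and> f 0 = 0 \<and> deriv f 0 = 1}"

definition class_P :: "(complex \<Rightarrow> complex) set" where
  "class_P = {p. p holomorphic_on \<bbbD> \<and> p 0 = 1 \<and> (\<forall>z\<in>\<bbbD>. Re (p z) > 0)}"

definition class_P_half :: "(complex \<Rightarrow> complex) set" where
  "class_P_half = {p \<in> class_P. \<forall>z\<in>\<bbbD>. Re (p z) > 1 / 2}"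

text \<open>
  Quotients are taken with their removable singularities filled in, by \<^const>\<open>remove_sings\<close>.
  At a genuine pole in \<open>\<bbbD>\<close> it returns \<open>0\<close>, so the resulting function is not continuous
  there; membership in \<^const>\<open>class_P\<close>, or subordination to a holomorphic function, therefore
  excludes poles.
\<close>

definition class_G1 :: "(complex \<Rightarrow> complex) set" where
  "class_G1 = {f \<in> class_A. \<exists>g\<in>class_A. \<exists>p\<in>class_P.
     remove_sings (\<lambda>z. f z / g z) \<in> class_P \<and>
     remove_sings (\<lambda>z. g z / (z * p z)) \<in> class_P}"

definition class_G2 :: "(complex \<Rightarrow> complex) set" where
  "class_G2 = {f \<in> class_A. \<exists>g\<in>class_A. \<exists>p\<in>class_P.
     remove_sings (\<lambda>z. f z / g z) \<in> class_P \<and>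
     remove_sings (\<lambda>z. g z / (z * p z)) \<in> class_P_half}"

definition class_G3 :: "(complex \<Rightarrow> complex) set" where
  "class_G3 = {f \<in> class_A. \<exists>p\<in>class_P. remove_sings (\<lambda>z. f z / (z * p z)) \<in> class_P}"

definition subordinate :: "(complex \<Rightarrow> complex) \<Rightarrow> (complex \<Rightarrow> complex) \<Rightarrow> bool"
    (infix "\<prec>\<^sub>s" 50) where
  "f \<prec>\<^sub>s g \<longleftrightarrow>
     (\<exists>w. w holomorphic_on \<bbbD> \<and> w ` \<bbbD> \<subseteq> \<bbbD> \<and> w 0 = 0 \<and> (\<forall>z\<in>\<bbbD>. f z = g (w z)))"

definition starlike_class :: "(complex \<Rightarrow> complex) \<Rightarrow> (complex \<Rightarrow> complex) set" where
  "starlike_class \<phi> = {f \<in> class_A. remove_sings (\<lambda>z. z * deriv f z / f z) \<prec>\<^sub>s \<phi>}"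

text \<open>
  The branch of the square root is immaterial: replacing \<open>\<surd>z\<close> by \<open>-\<surd>z\<close> changes the sign of the
  logarithm, which is squared. For \<open>z \<in> \<bbbD>\<close> the argument of the logarithm lies in the right
  half-plane, so \<^const>\<open>Ln\<close> is the intended branch.
\<close>

definition phi_PAR :: "complex \<Rightarrow> complex" where
  "phi_PAR z = 1 + 2 / (of_real pi)\<^sup>2 * (Ln ((1 + csqrt z) / (1 - csqrt z)))\<^sup>2"

definition parabolic_starlike :: "(complex \<Rightarrow> complex) set" where
  "parabolic_starlike = starlike_class phi_PAR"

text \<open>
  \<open>is_class_radius \<G> \<F> R\<close> says that the \<open>\<G>\<close>-radius of \<open>\<F>\<close> exists and equals \<open>R\<close>.
\<close>

definition radius_admissible ::
    "(complex \<Rightarrow> complex) set \<Rightarrow> (complex \<Rightarrow> complex) set \<Rightarrow> real \<Rightarrow> bool" where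
  "radius_admissible \<G> \<F> R \<longleftrightarrow>
     (\<forall>f\<in>\<F>. \<forall>r. 0 < r \<and> r < R \<longrightarrow>
        (\<lambda>z. inverse (complex_of_real r) * f (complex_of_real r * z)) \<in> \<G>)"

definition is_class_radius ::
    "(complex \<Rightarrow> complex) set \<Rightarrow> (complex \<Rightarrow> complex) set \<Rightarrow> real \<Rightarrow> bool" where
  "is_class_radius \<G> \<F> R \<longleftrightarrow>
     R \<in> {0<..<1} \<and> radius_admissible \<G> \<F> R \<and>
     (\<forall>R'\<in>{0<..<1}. radius_admissible \<G> \<F> R' \<longrightarrow> R' \<le> R)"

end

theory Submission
  imports Defs
begin

text \<open>
  Filling in the removable singularities turns the three class definitions into product formulas:
  \<open>f z = z * q z\<close>, where \<open>q\<close> is a product of three functions in \<^const>\<open>class_P\<close> for the first class,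
  of two of them and one in \<^const>\<open>class_P_half\<close> for the second, and of two functions in
  \<^const>\<open>class_P\<close> for the third. Hence \<open>z f'/f - 1\<close> is the sum of the terms \<open>z p'/p\<close> over the
  factors \<open>p\<close> of \<open>q\<close>. On \<open>\<bar>z\<bar> = \<rho>\<close> such a term is at most \<open>2\<rho>/(1 - \<rho>\<^sup>2)\<close> for \<open>p\<close> in \<^const>\<open>class_P\<close>
  (Schwarz--Pick for the half-plane) and at most \<open>\<rho>/(1 - \<rho>)\<close> for \<open>p\<close> in \<^const>\<open>class_P_half\<close>. The three
  radii are the values of \<open>\<rho>\<close> at which the sum of these bounds reaches \<open>1/2\<close>.

  The number \<open>1/2\<close> is the distance from \<open>1\<close> to the boundary of the parabolic region. That the disc
  \<open>\<bar>w - 1\<bar> < 1/2\<close> lies in the image of \<^const>\<open>phi_PAR\<close> is needed in the strong form of subordination,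
  so an inverse of \<^const>\<open>phi_PAR\<close> that is holomorphic on this disc is written down: it is
  \<open>tanh\<^sup>2\<close> of a multiple of \<open>\<surd>(w - 1)\<close>, and the branch cut disappears because \<open>tanh\<^sup>2\<close> is even
  (lemmas \<open>even_comp_csqrt_holomorphic\<close> and \<open>phi_PAR_inv\<close>).

  For sharpness, \<^const>\<open>phi_PAR\<close> takes only values of real part above \<open>1/2\<close>, since \<open>Ln\<close> maps the right
  half-plane into the strip \<open>\<bar>Im\<bar> < \<pi>/2\<close>. The functions \<open>z ((1 + z)/(1 - z))\<^sup>n\<close> with \<open>n = 3\<close>
  and \<open>n = 2\<close> belong to the first and the third class, and at the negative of the claimed radius
  \<open>z f'/f\<close> equals exactly \<open>1/2\<close>. The function with \<open>n = 2\<close> also belongs to the second class; this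
  keeps the admissible radii of that class away from \<open>1\<close>, so their supremum is a radius.
\<close>

section \<open>The parabolic region\<close>

lemma Cayley_Re_pos:
  assumes "cmod w < 1"
  shows "Re ((1 + w) / (1 - w)) > 0"
proof -
  have ne: "1 - w \<noteq> 0" using assms by auto
  have "(cmod w)\<^sup>2 < 1" using assms by (simp add: power_less_one_iff)
  hence "(Re w)\<^sup>2 + (Im w)\<^sup>2 < 1" by (simp add: cmod_power2)
  hence "Re ((1 + w) * cnj (1 - w)) > 0" by (simp add: algebra_simps power2_eq_square)
  moreover have "(1 + w) / (1 - w) = (1 + w) * cnj (1 - w) / complex_of_real ((cmod (1 - w))\<^sup>2)"
    by (rule complex_div_cnj[of "1 + w" "1 - w"])
  ultimately show ?thesis using ne by (simp only: Re_divide_of_real) (simp add: divide_pos_pos)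
qed

lemma Cayley_inverse_norm_less:
  assumes "Re v > 0"
  shows "cmod ((v - 1) / (v + 1)) < 1"
proof -
  have "v + 1 \<noteq> 0" using assms by (auto simp: complex_eq_iff)
  moreover have "(cmod (v - 1))\<^sup>2 < (cmod (v + 1))\<^sup>2"
    using assms unfolding cmod_power2 by (simp add: power2_eq_square algebra_simps)
  hence "cmod (v - 1) < cmod (v + 1)" using power2_less_imp_less norm_ge_zero by blast
  ultimately show ?thesis by (simp add: norm_divide)
qed

lemma norm_csqrt_less:
  assumes "cmod u < \<rho>\<^sup>2" "0 < \<rho>"
  shows "cmod (csqrt u) < \<rho>"
proof -
  have "(cmod (csqrt u))\<^sup>2 < \<rho>\<^sup>2"
    using assms by (simp add: norm_power[symmetric])
  thus ?thesis using assms(2) power2_less_imp_less by fastforce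
qed

text \<open>
  The square \<open>L\<^sup>2\<close> of a logarithm with \<open>\<bar>Im L\<bar> < \<pi>/2\<close> has real part at least \<open>- (Im L)\<^sup>2 > - \<pi>\<^sup>2/4\<close>.
  On the real axis this half-plane agrees with the parabolic region, which is all that the extremal
  functions test.
\<close>

lemma Re_phi_PAR_gt_half:
  assumes "cmod z < 1"
  shows "Re (phi_PAR z) > 1 / 2"
proof -
  define L where "L = Ln ((1 + csqrt z) / (1 - csqrt z))"
  have "cmod (csqrt z) < 1" using norm_csqrt_less[of z 1] assms by simp
  hence "\<bar>Im L\<bar> < pi / 2"
    unfolding L_def by (intro Re_Ln_pos_lt_imp Cayley_Re_pos)
  hence "(Im L)\<^sup>2 < (pi / 2)\<^sup>2"
    using abs_le_square_iff[of "pi/2" "Im L"] by auto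
  hence "(Im L)\<^sup>2 < pi\<^sup>2 / 4" by (simp add: power_divide)
  moreover have "Re (L\<^sup>2) = (Re L)\<^sup>2 - (Im L)\<^sup>2" by (rule Re_power2)
  ultimately have "Re (L\<^sup>2) > - (pi\<^sup>2 / 4)" using zero_le_power2[of "Re L"] by linarith
  hence "2 / pi\<^sup>2 * Re (L\<^sup>2) > 2 / pi\<^sup>2 * (- (pi\<^sup>2 / 4))"
    by (intro mult_strict_left_mono) auto
  moreover have "Re (phi_PAR z) = 1 + 2 / pi\<^sup>2 * Re (L\<^sup>2)"
  proof -
    have "phi_PAR z = 1 + complex_of_real (2 / pi\<^sup>2) * L\<^sup>2"
      by (simp add: phi_PAR_def L_def)
    thus ?thesis by (simp only: plus_complex.sel Re_complex_of_real times_complex.sel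
        Im_complex_of_real one_complex.sel mult_zero_left diff_zero)
  qed
  ultimately show ?thesis by simp
qed

text \<open>
  Away from the cut of \<^const>\<open>csqrt\<close> this is composition. On the cut, \<open>\<i> * csqrt (- u)\<close> is
  another square root of \<open>u\<close>, holomorphic there, and evenness makes the choice irrelevant. The branch
  point \<open>0\<close> is a removable singularity, by continuity.
\<close>

lemma even_comp_csqrt_holomorphic:
  fixes h :: "complex \<Rightarrow> complex"
  assumes hol: "h holomorphic_on ball 0 \<rho>" and \<rho>: "\<rho> > 0"
    and even: "\<And>s. s \<in> ball 0 \<rho> \<Longrightarrow> h (- s) = h s"
  shows "(\<lambda>u. h (csqrt u)) holomorphic_on ball 0 (\<rho>\<^sup>2)"
proof (rule no_isolated_singularity')
  let ?B = "ball (0::complex) (\<rho>\<^sup>2)"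
  have sq: "csqrt u \<in> ball 0 \<rho>" if "u \<in> ?B" for u
    using norm_csqrt_less[of u \<rho>] that \<rho> by simp
  have 1: "(\<lambda>u. h (csqrt u)) holomorphic_on ?B - \<real>\<^sub>\<le>\<^sub>0"
    by (rule holomorphic_on_compose_gen[OF _ hol, unfolded o_def])
       (use sq in \<open>auto intro!: holomorphic_intros\<close>)
  have "(\<lambda>u. h (\<i> * csqrt (- u))) holomorphic_on ?B - \<real>\<^sub>\<ge>\<^sub>0"
    by (rule holomorphic_on_compose_gen[OF _ hol, unfolded o_def])
       (use sq[of "- _"] in \<open>auto intro!: holomorphic_intros simp: norm_mult complex_nonpos_Reals_iff complex_nonneg_Reals_iff\<close>)
  moreover have "h (\<i> * csqrt (- u)) = h (csqrt u)" if "u \<in> ?B" for u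
  proof -
    have "(\<i> * csqrt (- u))\<^sup>2 = (csqrt u)\<^sup>2" by (simp add: power_mult_distrib)
    hence "\<i> * csqrt (- u) = csqrt u \<or> \<i> * csqrt (- u) = - csqrt u"
      by (rule power2_eq_iff[THEN iffD1])
    thus ?thesis using even[OF sq[OF that]] by auto
  qed
  ultimately have 2: "(\<lambda>u. h (csqrt u)) holomorphic_on ?B - \<real>\<^sub>\<ge>\<^sub>0"
    by (subst holomorphic_cong[OF refl, where g = "\<lambda>u. h (\<i> * csqrt (- u))"]) auto
  have "(\<lambda>u. h (csqrt u)) holomorphic_on (?B - \<real>\<^sub>\<le>\<^sub>0) \<union> (?B - \<real>\<^sub>\<ge>\<^sub>0)"
    by (rule holomorphic_on_Un[OF 1 2]) (auto intro!: open_Diff closed_nonneg_Reals_complex closed_nonpos_Reals_complex)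
  moreover have "(?B - \<real>\<^sub>\<le>\<^sub>0) \<union> (?B - \<real>\<^sub>\<ge>\<^sub>0) = ?B - {0}"
    by (auto simp: complex_nonpos_Reals_iff complex_nonneg_Reals_iff complex_eq_iff)
  ultimately show "(\<lambda>u. h (csqrt u)) holomorphic_on ?B - {0}" by simp
next
  fix z :: complex
  assume "z \<in> {0}"
  hence [simp]: "z = 0" by simp
  have "isCont h (csqrt 0)"
    using holomorphic_on_imp_continuous_on[OF hol] \<rho> by (auto simp: continuous_on_eq_continuous_at)
  moreover have "(csqrt \<longlongrightarrow> csqrt 0) (at 0)"
  proof -
    have "((\<lambda>u. sqrt (cmod u)) \<longlongrightarrow> sqrt (cmod 0)) (at (0::complex))" by (intro tendsto_intros)
    moreover have "cmod (csqrt u) = sqrt (cmod u)" for u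
      by (metis norm_ge_zero norm_power power2_csqrt real_sqrt_unique)
    ultimately have "((\<lambda>u. cmod (csqrt u)) \<longlongrightarrow> 0) (at 0)" by simp
    thus ?thesis unfolding csqrt_0 by (rule tendsto_norm_zero_cancel)
  qed
  ultimately have "((\<lambda>u. h (csqrt u)) \<longlongrightarrow> h (csqrt 0)) (at 0)"
    by (rule isCont_tendsto_compose)
  thus "((\<lambda>u. h (csqrt u)) \<longlongrightarrow> h (csqrt z)) (at z within ball 0 (\<rho>\<^sup>2))"
    using Lim_at_imp_Lim_at_within by fastforce
qed auto

text \<open>
  With \<open>L\<close> the logarithm in \<^const>\<open>phi_PAR\<close>, the value \<open>w\<close> determines \<open>L\<^sup>2 = \<pi>\<^sup>2 (w - 1)/2\<close>, and the
  argument is \<open>tanh\<^sup>2 (L/2)\<close>, written here with exponentials so that the Cayley transform is visible.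
\<close>

definition phi_PAR_inv :: "complex \<Rightarrow> complex" where
  "phi_PAR_inv w = (let L = csqrt ((of_real pi)\<^sup>2 / 2 * (w - 1)) in ((exp L - 1) / (exp L + 1))\<^sup>2)"

lemma Re_exp_pos:
  assumes "cmod L < pi / 2"
  shows "Re (exp L) > 0"
proof -
  have "\<bar>Im L\<bar> < pi / 2" using assms abs_Im_le_cmod[of L] by linarith
  thus ?thesis by (simp add: Re_exp cos_gt_zero_pi)
qed

text \<open>
  The radius \<open>1/2\<close> is what makes \<open>\<bar>L\<bar> < \<pi>/2\<close>, hence \<open>Re (exp L) > 0\<close>.
\<close>

lemma norm_phi_PAR_arg_less:
  assumes "w \<in> ball 1 (1 / 2)"
  shows "cmod ((of_real pi)\<^sup>2 / 2 * (w - 1)) < (pi / 2)\<^sup>2"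
proof -
  have "cmod (w - 1) < 1 / 2" using assms by (simp add: dist_norm norm_minus_commute)
  hence "pi\<^sup>2 / 2 * cmod (w - 1) < pi\<^sup>2 / 2 * (1 / 2)" by (intro mult_strict_left_mono) auto
  moreover have "cmod ((of_real pi)\<^sup>2 / 2 * (w - 1)) = pi\<^sup>2 / 2 * cmod (w - 1)"
    by (simp add: norm_mult norm_divide norm_power)
  ultimately show ?thesis by (simp add: power2_eq_square)
qed

lemma phi_PAR_inv_holomorphic: "phi_PAR_inv holomorphic_on ball 1 (1 / 2)"
proof -
  define h where "h = (\<lambda>s::complex. ((exp s - 1) / (exp s + 1))\<^sup>2)"
  have ne: "exp s + 1 \<noteq> 0" if "s \<in> ball 0 (pi / 2)" for s :: complex
    using Re_exp_pos[of s] that by (auto simp: complex_eq_iff)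
  have "h holomorphic_on ball 0 (pi / 2)"
    unfolding h_def by (intro holomorphic_intros ne)
  moreover have "h (- s) = h s" if "s \<in> ball 0 (pi / 2)" for s
  proof -
    have "(exp (- s) - 1) / (exp (- s) + 1) = - ((exp s - 1) / (exp s + 1))"
      using ne[OF that] ne[of "- s"] that by (simp add: exp_minus divide_simps add.commute)
    thus ?thesis by (simp add: h_def)
  qed
  ultimately have "(\<lambda>u. h (csqrt u)) holomorphic_on ball 0 ((pi / 2)\<^sup>2)"
    by (intro even_comp_csqrt_holomorphic) auto
  hence "(\<lambda>w. h (csqrt ((of_real pi)\<^sup>2 / 2 * (w - 1)))) holomorphic_on ball 1 (1 / 2)"
    by (rule holomorphic_on_compose_gen[unfolded o_def, rotated])
       (use norm_phi_PAR_arg_less in \<open>auto intro!: holomorphic_intros simp: mem_ball_0 simp del: mem_ball\<close>)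
  thus ?thesis by (simp add: phi_PAR_inv_def[abs_def] h_def Let_def)
qed

text \<open>
  Both possible values \<open>\<plusminus>t\<close> of the square root occur; they lead to \<open>Ln (exp (\<plusminus>L)) = \<plusminus>L\<close>, which is
  then squared.
\<close>

lemma phi_PAR_inv:
  assumes "w \<in> ball 1 (1 / 2)"
  shows "cmod (phi_PAR_inv w) < 1" "phi_PAR (phi_PAR_inv w) = w"
proof -
  define L where "L = csqrt ((of_real pi)\<^sup>2 / 2 * (w - 1))"
  define t where "t = (exp L - 1) / (exp L + 1)"
  have inv: "phi_PAR_inv w = t\<^sup>2" by (simp add: phi_PAR_inv_def L_def t_def Let_def)
  have L: "cmod L < pi / 2"
    unfolding L_def by (intro norm_csqrt_less norm_phi_PAR_arg_less assms) auto
  have pos: "Re (exp L) > 0" by (rule Re_exp_pos[OF L])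
  have "cmod t < 1" unfolding t_def by (rule Cayley_inverse_norm_less[OF pos])
  thus "cmod (phi_PAR_inv w) < 1" by (simp add: inv norm_power power_less_one_iff)
  have ne: "exp L + 1 \<noteq> 0" using pos by (auto simp: complex_eq_iff)
  have t: "1 + t = 2 * exp L / (exp L + 1)" "1 - t = 2 / (exp L + 1)"
    using ne by (auto simp: t_def field_simps)
  have cay: "(1 + t) / (1 - t) = exp L" "(1 - t) / (1 + t) = exp (- L)"
    unfolding t exp_minus inverse_eq_divide using ne
    by (simp_all add: frac_eq_eq)
  have Im: "\<bar>Im L\<bar> < pi" using L abs_Im_le_cmod[of L] pi_gt_zero by linarith
  have "csqrt (t\<^sup>2) = t \<or> csqrt (t\<^sup>2) = - t"
    by (rule power2_eq_iff[THEN iffD1]) simp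
  hence "(Ln ((1 + csqrt (t\<^sup>2)) / (1 - csqrt (t\<^sup>2))))\<^sup>2 = L\<^sup>2"
  proof
    assume "csqrt (t\<^sup>2) = t"
    thus ?thesis using cay Im by (simp add: Ln_exp)
  next
    assume "csqrt (t\<^sup>2) = - t"
    hence "(1 + csqrt (t\<^sup>2)) / (1 - csqrt (t\<^sup>2)) = exp (- L)" using cay by simp
    moreover have "Ln (exp (- L)) = - L" using Im by (intro Ln_exp) auto
    ultimately show ?thesis by simp
  qed
  hence "phi_PAR (phi_PAR_inv w) = 1 + 2 / (of_real pi)\<^sup>2 * L\<^sup>2" by (simp add: phi_PAR_def inv)
  also have "L\<^sup>2 = (of_real pi)\<^sup>2 / 2 * (w - 1)" unfolding L_def by (rule power2_csqrt)
  also have "1 + 2 / (of_real pi)\<^sup>2 * ((of_real pi)\<^sup>2 / 2 * (w - 1)) = w"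
    by (simp add: diff_divide_distrib)
  finally show "phi_PAR (phi_PAR_inv w) = w" .
qed

section \<open>Logarithmic derivatives of functions with positive real part\<close>

text \<open>
  Precomposing with the disc automorphism that sends \<open>0\<close> to \<open>a\<close>, and postcomposing with the map
  \<open>v \<mapsto> (v - b)/(v + cnj b)\<close> of the half-plane onto the disc, where \<open>b = p a\<close>, gives a self-map of
  the disc fixing \<open>0\<close>. The claim is the Schwarz lemma for its derivative at \<open>0\<close>.
\<close>

lemma Schwarz_Pick_half_plane:
  assumes hol: "p holomorphic_on \<bbbD>" and pos: "\<And>z. z \<in> \<bbbD> \<Longrightarrow> Re (p z) > 0"
    and a: "a \<in> \<bbbD>"
  shows "cmod (deriv p a) * (1 - (cmod a)\<^sup>2) \<le> 2 * Re (p a)"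
proof -
  define M where "M = Moebius_function 0 (- a)"
  define b where "b = p a"
  define F where "F = (\<lambda>z. (p (M z) - b) / (p (M z) + cnj b))"
  have a1: "cmod a < 1" using a by simp
  have M_hol: "M holomorphic_on \<bbbD>"
    unfolding M_def by (rule Moebius_function_holomorphic) (use a1 in simp)
  have M_in: "M z \<in> \<bbbD>" if "z \<in> \<bbbD>" for z
    using Moebius_function_norm_lt_1[of "- a" z 0] that a1 by (simp add: M_def)
  have M0: "M 0 = a" by (simp add: M_def Moebius_function_of_zero)
  have pM_hol: "(\<lambda>z. p (M z)) holomorphic_on \<bbbD>"
    by (rule holomorphic_on_compose_gen[OF M_hol hol, unfolded o_def]) (use M_in in auto)
  have b: "Re b > 0" using pos[OF a] by (simp add: b_def)
  have ne: "p (M z) + cnj b \<noteq> 0" if "z \<in> \<bbbD>" for z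
    using pos[OF M_in[OF that]] b by (auto simp: complex_eq_iff)
  have F_hol: "F holomorphic_on \<bbbD>"
    unfolding F_def by (intro holomorphic_intros pM_hol ne)
  have F0: "F 0 = 0" by (simp add: F_def M0 b_def)
  have F_less: "cmod (F z) < 1" if "cmod z < 1" for z
  proof -
    define v where "v = p (M z)"
    have v: "Re v > 0" using pos[OF M_in] that by (simp add: v_def)
    have "Re v * Re b > 0" using v b by simp
    hence "(cmod (v - b))\<^sup>2 < (cmod (v + cnj b))\<^sup>2"
      unfolding cmod_power2 by (simp add: power2_eq_square algebra_simps)
    hence "cmod (v - b) < cmod (v + cnj b)" using power2_less_imp_less norm_ge_zero by blast
    thus ?thesis using ne[of z] that by (simp add: F_def v_def norm_divide)
  qed
  have "cmod (deriv F 0) \<le> 1"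
    by (rule Schwarz_Lemma(2)[OF F_hol F0 F_less, of 0]) auto
  moreover have "deriv F 0 = deriv p a * (1 - of_real ((cmod a)\<^sup>2)) / of_real (2 * Re b)"
  proof -
    have "(M has_field_derivative (1 - a * cnj a)) (at 0)"
      unfolding M_def Moebius_function_def
      by (auto intro!: derivative_eq_intros simp: algebra_simps)
    moreover have "(p has_field_derivative deriv p a) (at (M 0))"
      unfolding M0 using holomorphic_derivI[OF hol _ a] by simp
    ultimately have "((\<lambda>z. p (M z)) has_field_derivative deriv p a * (1 - a * cnj a)) (at 0)"
      by (rule DERIV_chain2[rotated])
    hence "(F has_field_derivative
        (deriv p a * (1 - a * cnj a) * (p (M 0) + cnj b) - (p (M 0) - b) * (deriv p a * (1 - a * cnj a)))
          / ((p (M 0) + cnj b) * (p (M 0) + cnj b))) (at 0)"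
      unfolding F_def using ne[of 0] by (auto intro!: derivative_eq_intros)
    hence "deriv F 0 = (deriv p a * (1 - a * cnj a) * (b + cnj b)) / ((b + cnj b) * (b + cnj b))"
      by (auto simp: M0 b_def[symmetric] dest: DERIV_imp_deriv)
    also have "\<dots> = deriv p a * (1 - a * cnj a) / (b + cnj b)"
      using ne[of 0] by (simp add: M0 b_def)
    finally show ?thesis
      by (simp add: complex_add_cnj complex_mult_cnj cmod_power2)
  qed
  moreover have "(cmod a)\<^sup>2 < 1" using a1 by (simp add: power_less_one_iff)
  hence "cmod (1 - of_real ((cmod a)\<^sup>2)) = 1 - (cmod a)\<^sup>2"
    by (metis norm_of_real of_real_1 of_real_diff abs_of_pos diff_gt_0_iff_gt)
  ultimately show ?thesis using b
    by (simp add: norm_divide norm_mult b_def divide_simps)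
qed

lemma class_PD:
  assumes "p \<in> class_P"
  shows "p holomorphic_on \<bbbD>" "p 0 = 1" "\<And>z. z \<in> \<bbbD> \<Longrightarrow> Re (p z) > 0" "\<And>z. z \<in> \<bbbD> \<Longrightarrow> p z \<noteq> 0"
  using assms by (force simp: class_P_def)+

lemma one_minus_norm_square_pos: "z \<in> \<bbbD> \<Longrightarrow> 0 < 1 - (cmod z)\<^sup>2"
  by (simp add: power_less_one_iff)

lemma class_P_log_deriv_bound:
  assumes p: "p \<in> class_P" and z: "z \<in> \<bbbD>"
  shows "cmod (z * deriv p z / p z) \<le> 2 * cmod z / (1 - (cmod z)\<^sup>2)"
proof -
  have "cmod (deriv p z) * (1 - (cmod z)\<^sup>2) \<le> 2 * Re (p z)"
    using p z by (intro Schwarz_Pick_half_plane) (auto simp: class_P_def)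
  also have "\<dots> \<le> 2 * cmod (p z)" using complex_Re_le_cmod[of "p z"] by simp
  finally have "cmod (deriv p z) / cmod (p z) \<le> 2 / (1 - (cmod z)\<^sup>2)"
    using one_minus_norm_square_pos[OF z] class_PD(4)[OF p z] by (simp add: field_simps)
  from mult_left_mono[OF this, of "cmod z"] show ?thesis
    by (simp add: norm_mult norm_divide mult.commute)
qed

text \<open>
  Two consequences of the Schwarz lemma are combined. Schwarz--Pick for \<open>2p - 1\<close> gives
  \<open>\<bar>p'\<bar> (1 - r\<^sup>2) \<le> 2 Re p - 1\<close>. The condition \<open>Re p > 1/2\<close> says that \<open>w = 1 - 1/p\<close> maps the disc
  into itself, so that \<open>\<bar>w\<bar> \<le> r\<close>; and \<open>2 Re p - 1 = (1 - \<bar>w\<bar>\<^sup>2) \<bar>p\<bar>\<^sup>2 \<le> (1 + \<bar>w\<bar>) \<bar>p\<bar>\<close> because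
  \<open>\<bar>p\<bar> = 1/\<bar>1 - w\<bar>\<close>.
\<close>

lemma class_P_half_log_deriv_bound:
  assumes p: "p \<in> class_P_half" and z: "z \<in> \<bbbD>"
  shows "cmod (z * deriv p z / p z) \<le> cmod z / (1 - cmod z)"
proof -
  have pP: "p \<in> class_P" and half: "\<And>x. x \<in> \<bbbD> \<Longrightarrow> Re (p x) > 1 / 2"
    using p by (auto simp: class_P_half_def)
  note P = class_PD[OF pP]
  define w where "w = (\<lambda>x. 1 - 1 / p x)"
  have norm_w: "1 - (cmod (w x))\<^sup>2 = (2 * Re (p x) - 1) / (cmod (p x))\<^sup>2" if "x \<in> \<bbbD>" for x
  proof -
    have "w x = (p x - 1) / p x" using P(4)[OF that] by (simp add: w_def diff_divide_distrib)
    hence "(cmod (w x))\<^sup>2 = (cmod (p x - 1))\<^sup>2 / (cmod (p x))\<^sup>2"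
      by (simp only: norm_divide power_divide)
    hence "1 - (cmod (w x))\<^sup>2 = ((cmod (p x))\<^sup>2 - (cmod (p x - 1))\<^sup>2) / (cmod (p x))\<^sup>2"
      using P(4)[OF that] by (simp add: diff_divide_distrib)
    also have "(cmod (p x))\<^sup>2 - (cmod (p x - 1))\<^sup>2 = 2 * Re (p x) - 1"
      unfolding cmod_power2 by (simp add: power2_eq_square algebra_simps)
    finally show ?thesis .
  qed
  have w_less: "cmod (w x) < 1" if "cmod x < 1" for x
  proof -
    have "(2 * Re (p x) - 1) / (cmod (p x))\<^sup>2 > 0"
      using half[of x] P(4)[of x] that by (intro divide_pos_pos) auto
    hence "(cmod (w x))\<^sup>2 < 1" using norm_w[of x] that by simp
    thus ?thesis by (simp add: power_less_one_iff)
  qed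
  have "w holomorphic_on \<bbbD>" unfolding w_def by (intro holomorphic_intros P)
  hence wz: "cmod (w z) \<le> cmod z"
    by (rule Schwarz_Lemma(1)) (use z w_less P(2) in \<open>auto simp: w_def\<close>)
  define r where "r = cmod z"
  have r: "0 \<le> r" "r < 1" using z by (auto simp: r_def)
  have "cmod (deriv (\<lambda>x. 2 * p x - 1) z) * (1 - r\<^sup>2) \<le> 2 * Re (2 * p z - 1)"
    unfolding r_def using half z
    by (intro Schwarz_Pick_half_plane holomorphic_intros P) (auto simp: field_simps)
  moreover have "deriv (\<lambda>x. 2 * p x - 1) z = 2 * deriv p z"
    using holomorphic_derivI[OF P(1) _ z] by (intro DERIV_imp_deriv) (auto intro!: derivative_eq_intros)
  ultimately have "cmod (deriv p z) * (1 - r\<^sup>2) \<le> 2 * Re (p z) - 1"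
    by (simp add: norm_mult)
  also have "\<dots> = (1 - (cmod (w z))\<^sup>2) * (cmod (p z))\<^sup>2"
    using norm_w[OF z] P(4)[OF z] by (simp add: field_simps)
  also have "\<dots> \<le> (1 + r) * cmod (p z)"
  proof -
    have "(1 - cmod (w z)) * cmod (p z) \<le> cmod (1 - w z) * cmod (p z)"
      using norm_triangle_ineq2[of 1 "w z"] by (intro mult_right_mono) auto
    also have "\<dots> = 1" using P(4)[OF z] by (simp add: w_def norm_divide)
    finally have "(1 + cmod (w z)) * cmod (p z) * ((1 - cmod (w z)) * cmod (p z))
        \<le> (1 + cmod (w z)) * cmod (p z) * 1"
      by (intro mult_left_mono) auto
    also have "\<dots> \<le> (1 + r) * cmod (p z)" using wz by (simp add: r_def mult_right_mono)
    finally show ?thesis by (simp add: power2_eq_square algebra_simps)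
  qed
  finally have "cmod (deriv p z) * (1 - r) * (1 + r) \<le> cmod (p z) * (1 + r)"
    by (simp add: power2_eq_square algebra_simps)
  hence "cmod (deriv p z) * (1 - r) \<le> cmod (p z)"
    using r by (simp add: mult_le_cancel_right)
  hence "cmod (deriv p z) / cmod (p z) \<le> 1 / (1 - r)"
    using r P(4)[OF z] by (simp add: field_simps)
  from mult_left_mono[OF this, of "cmod z"] show ?thesis
    by (simp add: norm_mult norm_divide r_def)
qed

lemma log_deriv_mult:
  assumes "p holomorphic_on \<bbbD>" "q holomorphic_on \<bbbD>" "z \<in> \<bbbD>" "p z \<noteq> 0" "q z \<noteq> 0"
  shows "z * deriv (\<lambda>x. p x * q x) z / (p z * q z) = z * deriv p z / p z + z * deriv q z / q z"
proof -
  have "deriv (\<lambda>x. p x * q x) z = p z * deriv q z + deriv p z * q z"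
    using assms by (intro deriv_mult) (auto simp: holomorphic_on_imp_differentiable_at)
  thus ?thesis using assms by (simp add: field_simps)
qed

lemma log_deriv_mult3_bound:
  assumes "p \<in> class_P" "q \<in> class_P" "s \<in> class_P" and z: "z \<in> \<bbbD>"
  shows "cmod (z * deriv (\<lambda>z. p z * (q z * s z)) z / (p z * (q z * s z)))
    \<le> cmod (z * deriv p z / p z) + (cmod (z * deriv q z / q z) + cmod (z * deriv s z / s z))"
proof -
  note P = assms(1-3)[THEN class_PD(1)] assms(1-3)[THEN class_PD(4), OF z]
  have "z * deriv (\<lambda>z. p z * (q z * s z)) z / (p z * (q z * s z))
      = z * deriv p z / p z + z * deriv (\<lambda>z. q z * s z) z / (q z * s z)"
    using P z by (intro log_deriv_mult holomorphic_on_mult) auto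
  also have "z * deriv (\<lambda>z. q z * s z) z / (q z * s z) = z * deriv q z / q z + z * deriv s z / s z"
    using P z by (intro log_deriv_mult) auto
  finally have "z * deriv (\<lambda>z. p z * (q z * s z)) z / (p z * (q z * s z))
      = z * deriv p z / p z + (z * deriv q z / q z + z * deriv s z / s z)" .
  hence "cmod (z * deriv (\<lambda>z. p z * (q z * s z)) z / (p z * (q z * s z)))
      = cmod (z * deriv p z / p z + (z * deriv q z / q z + z * deriv s z / s z))" by simp
  thus ?thesis
    using norm_triangle_ineq[of "z * deriv p z / p z" "z * deriv q z / q z + z * deriv s z / s z"]
      norm_triangle_ineq[of "z * deriv q z / q z" "z * deriv s z / s z"] by linarith
qed

section \<open>Removable singularities of quotients\<close>

lemma remove_sings_eq_on_disc:
  assumes q: "q holomorphic_on \<bbbD>" and eq: "\<And>x. x \<in> \<bbbD> - {0} \<Longrightarrow> F x = q x" and z: "z \<in> \<bbbD>"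
  shows "remove_sings F z = q z"
proof (rule remove_sings_eqI)
  have lim: "(q \<longlongrightarrow> q z) (at z)"
    using q z holomorphic_on_imp_continuous_on[OF q]
    by (auto simp: continuous_on_eq_continuous_at isCont_def)
  have "\<forall>\<^sub>F x in at z. x \<in> \<bbbD> - {z}"
    using z eventually_at_in_open[of \<bbbD> z] by auto
  moreover have "\<forall>\<^sub>F x in at z. x \<noteq> 0"
    by (cases "z = 0") (auto simp: eventually_at_filter intro: eventually_mono[OF t1_space_nhds])
  ultimately have "\<forall>\<^sub>F x in at z. q x = F x"
    by eventually_elim (auto simp: eq)
  thus "(F \<longlongrightarrow> q z) (at z)" by (rule Lim_transform_eventually[OF lim])
qed

lemma class_P_cong:
  assumes "p \<in> class_P" "\<And>z. z \<in> \<bbbD> \<Longrightarrow> q z = p z"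
  shows "q \<in> class_P"
  using assms holomorphic_cong[OF refl, of \<bbbD> q p] by (auto simp: class_P_def)

text \<open>
  The extended quotient has no zeros in \<open>\<bbbD>\<close>, whereas \<^const>\<open>remove_sings\<close> is \<open>0\<close> wherever the quotient
  has no limit. So the limit exists at every point, and since the zeros of \<open>h\<close> are isolated
  (\<open>h\<close> does not vanish identically on the connected disc), the
  identity \<open>f = (f/h) h\<close> passes to the limit.
\<close>

lemma remove_sings_quotient_mult:
  assumes f: "f holomorphic_on \<bbbD>" and h: "h holomorphic_on \<bbbD>"
    and nz: "\<beta> \<in> \<bbbD>" "h \<beta> \<noteq> 0"
    and P: "remove_sings (\<lambda>z. f z / h z) \<in> class_P" and z: "z \<in> \<bbbD>"
  shows "f z = remove_sings (\<lambda>z. f z / h z) z * h z"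
proof -
  let ?q = "\<lambda>z. f z / h z"
  have "remove_sings ?q z \<noteq> 0" using class_PD(4)[OF P z] .
  then obtain c where c: "(?q \<longlongrightarrow> c) (at z)" unfolding remove_sings_def by metis
  hence rc: "remove_sings ?q z = c" by (rule remove_sings_eqI)
  have cont: "(f \<longlongrightarrow> f z) (at z)" "(h \<longlongrightarrow> h z) (at z)"
    using z holomorphic_on_imp_continuous_on[OF f] holomorphic_on_imp_continuous_on[OF h]
    by (auto simp: continuous_on_eq_continuous_at isCont_def)
  have "((\<lambda>x. ?q x * h x) \<longlongrightarrow> c * h z) (at z)" by (intro tendsto_mult c cont)
  moreover have "\<forall>\<^sub>F x in at z. h x \<noteq> 0 \<and> x \<in> \<bbbD>"
    by (rule non_zero_neighbour_alt[OF h _ _ z nz]) auto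
  hence "\<forall>\<^sub>F x in at z. ?q x * h x = f x" by (rule eventually_mono) auto
  ultimately have "(f \<longlongrightarrow> c * h z) (at z)" by (rule Lim_transform_eventually)
  from tendsto_unique[OF _ cont(1) this] show ?thesis by (simp add: rc)
qed

lemma class_A_nonzero:
  assumes "g \<in> class_A"
  obtains \<beta> where "\<beta> \<in> \<bbbD>" "g \<beta> \<noteq> 0"
proof -
  have False if "\<And>z. z \<in> \<bbbD> \<Longrightarrow> g z = 0"
  proof -
    have "deriv g 0 = deriv (\<lambda>_. 0) 0"
      by (rule deriv_cong_ev) (auto intro!: eventually_nhds_in_open[of \<bbbD> 0, THEN eventually_mono] simp: that)
    thus False using assms by (simp add: class_A_def)
  qed
  thus ?thesis using that by blast
qed

text \<open>
  This serves twice: \<open>h\<close> is a member of the third class, or the intermediate function \<open>g\<close> in the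
  definition of the first two classes.
\<close>

lemma class_G3_factor:
  assumes "h \<in> class_A" "p \<in> class_P" "remove_sings (\<lambda>z. h z / (z * p z)) \<in> class_P" "z \<in> \<bbbD>"
  shows "h z = z * (p z * remove_sings (\<lambda>z. h z / (z * p z)) z)"
proof -
  have "h z = remove_sings (\<lambda>z. h z / (z * p z)) z * (z * p z)"
    by (rule remove_sings_quotient_mult[where \<beta> = "1/2"])
       (use assms class_PD[OF assms(2)] in \<open>auto simp: class_A_def intro!: holomorphic_intros\<close>)
  thus ?thesis by (simp add: mult_ac)
qed

lemma class_G1_factor:
  assumes "f \<in> class_A" "g \<in> class_A" "p \<in> class_P"
    "remove_sings (\<lambda>z. f z / g z) \<in> class_P" "remove_sings (\<lambda>z. g z / (z * p z)) \<in> class_P" "z \<in> \<bbbD>"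
  shows "f z = z * (remove_sings (\<lambda>z. f z / g z) z * (p z * remove_sings (\<lambda>z. g z / (z * p z)) z))"
proof -
  obtain \<beta> where "\<beta> \<in> \<bbbD>" "g \<beta> \<noteq> 0" using class_A_nonzero[OF assms(2)] .
  hence "f z = remove_sings (\<lambda>z. f z / g z) z * g z"
    using assms by (intro remove_sings_quotient_mult[where \<beta> = \<beta>]) (auto simp: class_A_def)
  thus ?thesis using class_G3_factor[OF assms(2,3,5,6)] by (simp only: mult_ac)
qed

section \<open>Dilations and the parabolic starlike class\<close>

definition dilation :: "real \<Rightarrow> (complex \<Rightarrow> complex) \<Rightarrow> complex \<Rightarrow> complex" where
  "dilation r f = (\<lambda>z. inverse (complex_of_real r) * f (complex_of_real r * z))"

lemma of_real_mult_in_disc: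
  assumes "0 < r" "r < 1" "z \<in> \<bbbD>"
  shows "complex_of_real r * z \<in> \<bbbD>"
proof -
  have "r * cmod z \<le> 1 * cmod z" using assms by (intro mult_right_mono) auto
  thus ?thesis using assms by (simp add: norm_mult)
qed

lemma dilation_deriv:
  assumes "f holomorphic_on \<bbbD>" "0 < r" "r < 1" "z \<in> \<bbbD>"
  shows "deriv (dilation r f) z = deriv f (of_real r * z)"
proof -
  have "(f has_field_derivative deriv f (of_real r * z)) (at (of_real r * z))"
    using holomorphic_derivI[OF assms(1) _ of_real_mult_in_disc] assms by simp
  moreover have "((\<lambda>z. of_real r * z) has_field_derivative of_real r) (at z)"
    by (auto intro!: derivative_eq_intros)
  ultimately have "((\<lambda>z. f (of_real r * z)) has_field_derivative deriv f (of_real r * z) * of_real r) (at z)"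
    by (rule DERIV_chain2)
  from DERIV_cmult[OF this, of "inverse (of_real r)"] show ?thesis
    unfolding dilation_def using assms(2) by (intro DERIV_imp_deriv) (simp add: field_simps)
qed

lemma dilation_class_A:
  assumes "f \<in> class_A" "0 < r" "r < 1"
  shows "dilation r f \<in> class_A"
proof -
  have f: "f holomorphic_on \<bbbD>" using assms by (simp add: class_A_def)
  have "(\<lambda>z. f (of_real r * z)) holomorphic_on \<bbbD>"
    by (rule holomorphic_on_compose_gen[OF _ f, unfolded o_def])
       (use of_real_mult_in_disc assms in \<open>auto intro!: holomorphic_intros\<close>)
  thus ?thesis using assms dilation_deriv[OF f assms(2,3), of 0]
    by (auto simp: class_A_def dilation_def intro!: holomorphic_intros)
qed

text \<open>
  The factorisation \<open>f z = z * q z\<close> shows that \<open>z f'/f\<close> extends to \<open>1 + z q'/q\<close>, also at \<open>0\<close>; the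
  dilation replaces \<open>z\<close> by \<open>r z\<close>.
\<close>

lemma dilation_log_deriv:
  assumes f: "f holomorphic_on \<bbbD>" and q: "q holomorphic_on \<bbbD>"
    and fq: "\<forall>z\<in>\<bbbD>. q z \<noteq> 0 \<and> f z = z * q z" and r: "0 < r" "r < 1"
  defines "Q \<equiv> \<lambda>z. 1 + (of_real r * z) * deriv q (of_real r * z) / q (of_real r * z)"
  shows "Q holomorphic_on \<bbbD>"
    and "\<And>z. z \<in> \<bbbD> \<Longrightarrow> remove_sings (\<lambda>z. z * deriv (dilation r f) z / dilation r f z) z = Q z"
proof -
  note in_disc = of_real_mult_in_disc[OF r]
  have "(\<lambda>x. 1 + x * deriv q x / q x) holomorphic_on \<bbbD>"
    by (intro holomorphic_intros q) (use fq in auto)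
  thus Q: "Q holomorphic_on \<bbbD>"
    unfolding Q_def
    by (rule holomorphic_on_compose_gen[unfolded o_def, rotated])
       (use in_disc in \<open>auto intro!: holomorphic_intros\<close>)
  fix z assume z: "z \<in> \<bbbD>"
  show "remove_sings (\<lambda>z. z * deriv (dilation r f) z / dilation r f z) z = Q z"
  proof (rule remove_sings_eq_on_disc[OF Q _ z])
    fix x assume x: "x \<in> \<bbbD> - {0}"
    define y where "y = complex_of_real r * x"
    have y: "y \<in> \<bbbD>" "y \<noteq> 0" using x r in_disc by (auto simp: y_def)
    have "deriv f y = deriv (\<lambda>x. x * q x) y"
      by (rule deriv_cong_ev) (use y fq in \<open>auto intro!: eventually_nhds_in_open[of \<bbbD> y, THEN eventually_mono]\<close>)
    also have "\<dots> = y * deriv q y + q y"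
      using q y by (subst deriv_mult) (auto simp: holomorphic_on_imp_differentiable_at)
    finally have "deriv f y = y * deriv q y + q y" .
    moreover have "dilation r f x = x * q y"
      using fq y(1) r by (simp add: dilation_def y_def)
    moreover have "deriv (dilation r f) x = deriv f y"
      using dilation_deriv[OF f r] x by (simp add: y_def)
    ultimately have "x * deriv (dilation r f) x / dilation r f x = (y * deriv q y + q y) / q y"
      using x by simp
    also have "\<dots> = Q x" using fq y(1) by (simp add: Q_def y_def[symmetric] add_divide_distrib)
    finally show "x * deriv (dilation r f) x / dilation r f x = Q x" .
  qed
qed

text \<open>
  The bound puts \<open>z f'/f\<close> of the dilation into the disc of radius \<open>1/2\<close> about \<open>1\<close>, where
  \<^const>\<open>phi_PAR_inv\<close> is holomorphic; composing with it gives the Schwarz function.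
\<close>

lemma dilation_parabolic_starlike:
  assumes f: "f \<in> class_A" and q: "q holomorphic_on \<bbbD>"
    and fq: "\<forall>z\<in>\<bbbD>. q z \<noteq> 0 \<and> f z = z * q z" and r: "0 < r" "r < 1"
    and bound: "\<And>z. cmod z < r \<Longrightarrow> cmod (z * deriv q z / q z) < 1 / 2"
  shows "dilation r f \<in> parabolic_starlike"
proof -
  define Q where "Q = (\<lambda>z. 1 + (of_real r * z) * deriv q (of_real r * z) / q (of_real r * z))"
  have hf: "f holomorphic_on \<bbbD>" using f by (simp add: class_A_def)
  note Q = dilation_log_deriv[OF hf q fq r, folded Q_def]
  have Q_in: "Q z \<in> ball 1 (1 / 2)" if "z \<in> \<bbbD>" for z
    using bound[of "of_real r * z"] that r by (simp add: Q_def dist_norm norm_mult norm_minus_commute)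
  define w where "w = (\<lambda>z. phi_PAR_inv (Q z))"
  have "w holomorphic_on \<bbbD>"
    unfolding w_def using Q_in
    by (intro holomorphic_on_compose_gen[OF Q(1) phi_PAR_inv_holomorphic, unfolded o_def]) auto
  moreover have "w ` \<bbbD> \<subseteq> \<bbbD>" using phi_PAR_inv(1) Q_in by (auto simp: w_def)
  moreover have "w 0 = 0" by (simp add: w_def Q_def phi_PAR_inv_def)
  moreover have "remove_sings (\<lambda>z. z * deriv (dilation r f) z / dilation r f z) z = phi_PAR (w z)"
    if "z \<in> \<bbbD>" for z
    using Q(2)[OF that] phi_PAR_inv(2)[OF Q_in[OF that]] by (simp add: w_def Q_def)
  ultimately show ?thesis
    using dilation_class_A[OF f r] unfolding parabolic_starlike_def starlike_class_def subordinate_def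
    by blast
qed

lemma Re_log_deriv_gt_half:
  assumes f: "f holomorphic_on \<bbbD>" and q: "q holomorphic_on \<bbbD>"
    and fq: "\<forall>z\<in>\<bbbD>. q z \<noteq> 0 \<and> f z = z * q z" and r: "0 < r" "r < 1"
    and PS: "dilation r f \<in> parabolic_starlike" and z: "cmod z < r"
  shows "Re (1 + z * deriv q z / q z) > 1 / 2"
proof -
  have in_disc: "z / of_real r \<in> \<bbbD>" using z r by (simp add: norm_divide)
  obtain w where w: "w ` \<bbbD> \<subseteq> \<bbbD>"
      "\<And>z. z \<in> \<bbbD> \<Longrightarrow> remove_sings (\<lambda>z. z * deriv (dilation r f) z / dilation r f z) z = phi_PAR (w z)"
    using PS unfolding parabolic_starlike_def starlike_class_def subordinate_def by blast
  have "1 + z * deriv q z / q z = phi_PAR (w (z / of_real r))"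
    using w(2)[OF in_disc] dilation_log_deriv(2)[OF f q fq r in_disc] r by simp
  moreover have "cmod (w (z / of_real r)) < 1" using w(1) in_disc by (auto simp: image_subset_iff)
  ultimately show ?thesis using Re_phi_PAR_gt_half by simp
qed

section \<open>Extremal functions\<close>

definition Cayley :: "complex \<Rightarrow> complex" where
  "Cayley = (\<lambda>z. (1 + z) / (1 - z))"

lemma Cayley_class_P: "Cayley \<in> class_P"
proof -
  have "Cayley holomorphic_on \<bbbD>"
    unfolding Cayley_def by (intro holomorphic_intros) auto
  thus ?thesis using Cayley_Re_pos by (auto simp: class_P_def Cayley_def)
qed

definition extremal :: "nat \<Rightarrow> complex \<Rightarrow> complex" where
  "extremal n = (\<lambda>z. z * Cayley z ^ n)"

lemma extremal_class_A: "extremal n \<in> class_A"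
proof -
  note C = class_PD[OF Cayley_class_P]
  have "(\<lambda>z. Cayley z ^ n) holomorphic_on \<bbbD>" by (intro holomorphic_intros C)
  hence "(\<lambda>z. Cayley z ^ n) field_differentiable at 0"
    by (auto simp: holomorphic_on_imp_differentiable_at)
  hence "deriv (\<lambda>z. z * Cayley z ^ n) 0 = 1"
    by (subst deriv_mult) (simp_all add: C(2))
  hence "deriv (extremal n) 0 = 1" by (simp add: extremal_def)
  moreover have "extremal n holomorphic_on \<bbbD>"
    unfolding extremal_def by (intro holomorphic_intros C)
  ultimately show ?thesis by (simp add: class_A_def extremal_def)
qed

lemma Cayley_power_log_deriv:
  assumes "z \<in> \<bbbD>"
  shows "z * deriv (\<lambda>z. Cayley z ^ n) z / Cayley z ^ n = of_nat n * (2 * z / (1 - z\<^sup>2))"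
proof -
  have ne: "1 - z \<noteq> 0" "1 + z \<noteq> 0" using assms by (auto simp: add_eq_0_iff)
  have "(Cayley has_field_derivative 2 / (1 - z)\<^sup>2) (at z)"
    unfolding Cayley_def using ne by (auto intro!: derivative_eq_intros simp: power2_eq_square)
  hence d: "deriv (\<lambda>z. Cayley z ^ n) z = of_nat n * Cayley z ^ (n - 1) * (2 / (1 - z)\<^sup>2)"
    by (intro DERIV_imp_deriv) (auto intro!: derivative_eq_intros)
  show ?thesis
  proof (cases n)
    case (Suc m)
    have "Cayley z \<noteq> 0" using ne by (simp add: Cayley_def)
    hence "z * deriv (\<lambda>z. Cayley z ^ n) z / Cayley z ^ n = of_nat n * (z * (2 / (1 - z)\<^sup>2) / Cayley z)"
      using d Suc by simp
    also have "z * (2 / (1 - z)\<^sup>2) / Cayley z = 2 * z / ((1 - z) * (1 + z))"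
      using ne by (simp add: Cayley_def power2_eq_square)
    also have "(1 - z) * (1 + z) = 1 - z\<^sup>2" by (simp add: power2_eq_square algebra_simps)
    finally show ?thesis .
  qed simp
qed

text \<open>
  At \<open>z = - R\<close> the extension of \<open>z f'/f\<close> for the extremal function is \<open>1 - 2 n R/(1 - R\<^sup>2) = 1/2\<close>,
  a boundary value of the parabolic region. A dilation factor strictly between \<open>R\<close> and \<open>R'\<close>
  brings this point into the open disc.
\<close>

lemma radius_upper_bound:
  assumes adm: "radius_admissible parabolic_starlike \<F> R'" and ext: "extremal n \<in> \<F>"
    and R: "0 < R" "R < 1" "4 * real n * R = 1 - R\<^sup>2" and R': "R' < 1"
  shows "R' \<le> R"
proof (rule ccontr)
  assume "\<not> R' \<le> R"
  define r where "r = (R + R') / 2"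
  have r: "0 < r" "r < 1" "R < r" "r < R'" using \<open>\<not> R' \<le> R\<close> R R' by (auto simp: r_def)
  have "dilation r (extremal n) \<in> parabolic_starlike"
    using adm ext r unfolding radius_admissible_def dilation_def by blast
  hence "Re (1 + - of_real R * deriv (\<lambda>z. Cayley z ^ n) (- of_real R) / Cayley (- of_real R) ^ n) > 1 / 2"
    using r R extremal_class_A[of n] class_PD[OF Cayley_class_P]
    by (intro Re_log_deriv_gt_half[of "extremal n" _ r])
       (auto simp: class_A_def extremal_def intro!: holomorphic_intros)
  moreover have "- of_real R * deriv (\<lambda>z. Cayley z ^ n) (- of_real R) / Cayley (- of_real R) ^ n
      = complex_of_real (- (2 * real n * R / (1 - R\<^sup>2)))"
    using R by (subst Cayley_power_log_deriv) auto
  moreover have "2 * real n * R / (1 - R\<^sup>2) = 1 / 2"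
  proof -
    have "1 - R\<^sup>2 > 0" using R by (simp add: power_less_one_iff)
    thus ?thesis using R(3) by (simp add: field_simps)
  qed
  ultimately have "Re (1 + complex_of_real (- (1 / 2))) > 1 / 2" by (simp only:)
  thus False by simp
qed

lemma remove_sings_extremal_quotient:
  assumes "m \<le> n" "z \<in> \<bbbD>"
  shows "remove_sings (\<lambda>z. extremal n z / (z * Cayley z ^ m)) z = Cayley z ^ (n - m)"

proof (rule remove_sings_eq_on_disc[OF _ _ assms(2)])
  show "(\<lambda>z. Cayley z ^ (n - m)) holomorphic_on \<bbbD>"
    by (intro holomorphic_intros class_PD[OF Cayley_class_P])
  fix x assume "x \<in> \<bbbD> - {0}"
  thus "extremal n x / (x * Cayley x ^ m) = Cayley x ^ (n - m)"
    using class_PD(4)[OF Cayley_class_P, of x] assms by (simp add: extremal_def power_diff)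
qed

lemma extremal_class_G1: "extremal 3 \<in> class_G1"
proof -
  have "remove_sings (\<lambda>z. extremal 3 z / extremal 2 z) \<in> class_P"
    unfolding extremal_def[of 2]
    by (rule class_P_cong[OF Cayley_class_P]) (simp add: remove_sings_extremal_quotient)
  moreover have "remove_sings (\<lambda>z. extremal 2 z / (z * Cayley z)) \<in> class_P"
    using remove_sings_extremal_quotient[of 1 2] by (intro class_P_cong[OF Cayley_class_P]) simp
  ultimately show ?thesis
    using extremal_class_A Cayley_class_P unfolding class_G1_def by blast
qed

text \<open>
  The factor from \<^const>\<open>class_P_half\<close> is the constant \<open>1\<close>.
\<close>

lemma extremal_class_G2: "extremal 2 \<in> class_G2"
proof -
  have "remove_sings (\<lambda>z. extremal 2 z / extremal 1 z) \<in> class_P"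
    unfolding extremal_def[of 1]
    by (rule class_P_cong[OF Cayley_class_P]) (use remove_sings_extremal_quotient[of 1 2] in simp)
  moreover have "remove_sings (\<lambda>z. extremal 1 z / (z * Cayley z)) z = 1" if "z \<in> \<bbbD>" for z
    using remove_sings_extremal_quotient[of 1 1 z] that by simp
  hence "remove_sings (\<lambda>z. extremal 1 z / (z * Cayley z)) \<in> class_P_half"
    using class_P_cong[of "\<lambda>_. 1" "remove_sings (\<lambda>z. extremal 1 z / (z * Cayley z))"]
    by (auto simp: class_P_half_def class_P_def)
  ultimately show ?thesis
    using extremal_class_A Cayley_class_P unfolding class_G2_def by blast
qed

lemma extremal_class_G3: "extremal 2 \<in> class_G3"
proof -
  have "remove_sings (\<lambda>z. extremal 2 z / (z * Cayley z)) \<in> class_P"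
    using remove_sings_extremal_quotient[of 1 2] by (intro class_P_cong[OF Cayley_class_P]) simp
  thus ?thesis using extremal_class_A Cayley_class_P unfolding class_G3_def by blast
qed

section \<open>The radii\<close>

text \<open>
  \<open>B\<close> is a majorant, depending on \<open>\<bar>z\<bar>\<close> only, of \<open>\<bar>z f'/f - 1\<bar>\<close> for all members \<open>f\<close> of the class.
\<close>

lemma radius_admissibleI:
  assumes R: "R < 1"
    and fac: "\<And>f. f \<in> \<F> \<Longrightarrow> f \<in> class_A \<and> (\<exists>q. q holomorphic_on \<bbbD> \<and> (\<forall>z\<in>\<bbbD>. q z \<noteq> 0 \<and> f z = z * q z) \<and>
        (\<forall>z\<in>\<bbbD>. cmod (z * deriv q z / q z) \<le> B (cmod z)))"
    and B: "\<And>\<rho>. 0 \<le> \<rho> \<Longrightarrow> \<rho> < R \<Longrightarrow> B \<rho> < 1 / 2"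
  shows "radius_admissible parabolic_starlike \<F> R"
  unfolding radius_admissible_def
proof (intro ballI allI impI, elim conjE)
  fix f r assume f: "f \<in> \<F>" and r: "0 < r" "r < R"
  obtain q where q: "q holomorphic_on \<bbbD>" "\<forall>z\<in>\<bbbD>. q z \<noteq> 0 \<and> f z = z * q z"
      "\<And>z. z \<in> \<bbbD> \<Longrightarrow> cmod (z * deriv q z / q z) \<le> B (cmod z)"
    using fac[OF f] by blast
  have "cmod (z * deriv q z / q z) < 1 / 2" if "cmod z < r" for z
    using q(3)[of z] B[of "cmod z"] that r R by fastforce
  hence "dilation r f \<in> parabolic_starlike"
    using fac[OF f] q r R by (intro dilation_parabolic_starlike[of f q]) auto
  thus "(\<lambda>z. inverse (complex_of_real r) * f (complex_of_real r * z)) \<in> parabolic_starlike"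
    by (simp add: dilation_def)
qed

text \<open>
  Admissibility of a radius only concerns dilation factors strictly below it, so it is inherited by
  the supremum of the admissible radii. The bound \<open>B\<close> keeps the supremum below \<open>1\<close>.
\<close>

lemma is_class_radius_exists:
  assumes adm: "radius_admissible \<G> \<F> R0" and R0: "0 < R0"
    and upper: "\<And>R'. R' \<in> {0<..<1} \<Longrightarrow> radius_admissible \<G> \<F> R' \<Longrightarrow> R' \<le> B" and B: "B < 1"
    and R01: "R0 < 1"
  shows "\<exists>R. is_class_radius \<G> \<F> R \<and> R \<ge> R0"
proof -
  define S where "S = {R \<in> {0<..<1}. radius_admissible \<G> \<F> R}"
  have R0S: "R0 \<in> S" using assms by (simp add: S_def)
  have SB: "R \<le> B" if "R \<in> S" for R using that upper by (auto simp: S_def)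
  have bdd: "bdd_above S" using SB by (auto intro!: bdd_aboveI)
  have ge: "R \<le> Sup S" if "R \<in> S" for R using cSup_upper[OF that bdd] .
  have "Sup S \<le> B" using R0S SB by (intro cSup_least) auto
  moreover have "radius_admissible \<G> \<F> (Sup S)"
    unfolding radius_admissible_def
  proof (intro ballI allI impI, elim conjE)
    fix f r assume f: "f \<in> \<F>" and r: "0 < r" "r < Sup S"
    obtain R where "R \<in> S" "r < R" using less_cSupD[of S r] R0S r by blast
    thus "(\<lambda>z. inverse (complex_of_real r) * f (complex_of_real r * z)) \<in> \<G>"
      using f r by (auto simp: S_def radius_admissible_def)
  qed
  ultimately have "is_class_radius \<G> \<F> (Sup S)"
    unfolding is_class_radius_def using ge[OF R0S] R0 B ge by (auto simp: S_def)
  thus ?thesis using ge[OF R0S] by blast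
qed

text \<open>
  The equation for \<open>R\<close> says that the left-hand side is \<open>1/2\<close> at \<open>\<rho> = R\<close>, and it increases with \<open>\<rho>\<close>.
\<close>

lemma quadratic_bound_less_half:
  fixes a :: real
  assumes "0 \<le> \<rho>" "\<rho> < R" "R < 1" "4 * a * R = 1 - R\<^sup>2" "0 < a"
  shows "a * (2 * \<rho> / (1 - \<rho>\<^sup>2)) < 1 / 2"
proof -
  have sq: "\<rho>\<^sup>2 < R\<^sup>2" using assms by (intro power_strict_mono) auto
  have "R\<^sup>2 < 1" using assms by (simp add: power_less_one_iff)
  hence "0 < 1 - \<rho>\<^sup>2" using sq by simp
  moreover have "4 * a * \<rho> < 4 * a * R" using assms(2,5) by (intro mult_strict_left_mono) auto
  hence "4 * a * \<rho> < 1 - \<rho>\<^sup>2" using assms sq by linarith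
  ultimately show ?thesis by (simp add: divide_simps)
qed

lemma class_G1_admissible:
  assumes "R < 1" "12 * R = 1 - R\<^sup>2"
  shows "radius_admissible parabolic_starlike class_G1 R"
proof (rule radius_admissibleI[where B = "\<lambda>\<rho>. 3 * (2 * \<rho> / (1 - \<rho>\<^sup>2))"])
  fix f assume "f \<in> class_G1"
  then obtain g p where f: "f \<in> class_A" and g: "g \<in> class_A" and p: "p \<in> class_P"
    and P: "remove_sings (\<lambda>z. f z / g z) \<in> class_P" "remove_sings (\<lambda>z. g z / (z * p z)) \<in> class_P"
    unfolding class_G1_def by blast
  define p1 where "p1 = remove_sings (\<lambda>z. f z / g z)"
  define p2 where "p2 = remove_sings (\<lambda>z. g z / (z * p z))"
  note fac = class_G1_factor[OF f g p P, folded p1_def p2_def]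
  note P1 = P(1)[folded p1_def] and P2 = P(2)[folded p2_def]
  note D = class_PD[OF p] class_PD[OF P1] class_PD[OF P2]
  have "cmod (z * deriv (\<lambda>z. p1 z * (p z * p2 z)) z / (p1 z * (p z * p2 z))) \<le> 3 * (2 * cmod z / (1 - (cmod z)\<^sup>2))"
    if z: "z \<in> \<bbbD>" for z
  proof -
    have "cmod (z * deriv (\<lambda>z. p1 z * (p z * p2 z)) z / (p1 z * (p z * p2 z)))
        \<le> cmod (z * deriv p1 z / p1 z) + (cmod (z * deriv p z / p z) + cmod (z * deriv p2 z / p2 z))"
      by (rule log_deriv_mult3_bound[OF P1 p P2 z])
    also have "\<dots> \<le> 3 * (2 * cmod z / (1 - (cmod z)\<^sup>2))"
      using class_P_log_deriv_bound[OF p z] class_P_log_deriv_bound[OF P1 z] class_P_log_deriv_bound[OF P2 z]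
      by linarith
    finally show ?thesis .
  qed
  thus "f \<in> class_A \<and> (\<exists>q. q holomorphic_on \<bbbD> \<and> (\<forall>z\<in>\<bbbD>. q z \<noteq> 0 \<and> f z = z * q z) \<and>
        (\<forall>z\<in>\<bbbD>. cmod (z * deriv q z / q z) \<le> 3 * (2 * cmod z / (1 - (cmod z)\<^sup>2))))"
    using f fac D by (intro conjI exI[of _ "\<lambda>z. p1 z * (p z * p2 z)"]) (auto intro!: holomorphic_intros)
next
  fix \<rho> assume "0 \<le> \<rho>" "\<rho> < R"
  thus "3 * (2 * \<rho> / (1 - \<rho>\<^sup>2)) < 1 / 2"
    using assms by (intro quadratic_bound_less_half[of \<rho> R 3]) simp_all
qed (rule assms(1))

text \<open>
  The equation for \<open>R\<close> comes from \<open>4\<rho>/(1 - \<rho>\<^sup>2) + \<rho>/(1 - \<rho>) = (5\<rho> + \<rho>\<^sup>2)/(1 - \<rho>\<^sup>2)\<close>, set equal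
  to \<open>1/2\<close>.
\<close>

lemma class_G2_admissible:
  assumes "R < 1" "10 * R + 3 * R\<^sup>2 = 1"
  shows "radius_admissible parabolic_starlike class_G2 R"
proof (rule radius_admissibleI[where B = "\<lambda>\<rho>. 2 * (2 * \<rho> / (1 - \<rho>\<^sup>2)) + \<rho> / (1 - \<rho>)"])
  fix f assume "f \<in> class_G2"
  then obtain g p where f: "f \<in> class_A" and g: "g \<in> class_A" and p: "p \<in> class_P"
    and P: "remove_sings (\<lambda>z. f z / g z) \<in> class_P" "remove_sings (\<lambda>z. g z / (z * p z)) \<in> class_P"
    and half: "remove_sings (\<lambda>z. g z / (z * p z)) \<in> class_P_half"
    unfolding class_G2_def class_P_half_def by blast
  define p1 where "p1 = remove_sings (\<lambda>z. f z / g z)"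
  define p2 where "p2 = remove_sings (\<lambda>z. g z / (z * p z))"
  note fac = class_G1_factor[OF f g p P, folded p1_def p2_def]
  note P1 = P(1)[folded p1_def] and P2 = P(2)[folded p2_def] and P2h = half[folded p2_def]
  note D = class_PD[OF p] class_PD[OF P1] class_PD[OF P2]
  have "cmod (z * deriv (\<lambda>z. p1 z * (p z * p2 z)) z / (p1 z * (p z * p2 z)))
      \<le> 2 * (2 * cmod z / (1 - (cmod z)\<^sup>2)) + cmod z / (1 - cmod z)"
    if z: "z \<in> \<bbbD>" for z
  proof -
    have "cmod (z * deriv (\<lambda>z. p1 z * (p z * p2 z)) z / (p1 z * (p z * p2 z)))
        \<le> cmod (z * deriv p1 z / p1 z) + (cmod (z * deriv p z / p z) + cmod (z * deriv p2 z / p2 z))"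
      by (rule log_deriv_mult3_bound[OF P1 p P2 z])
    also have "\<dots> \<le> 2 * (2 * cmod z / (1 - (cmod z)\<^sup>2)) + cmod z / (1 - cmod z)"
      using class_P_log_deriv_bound[OF p z] class_P_log_deriv_bound[OF P1 z] class_P_half_log_deriv_bound[OF P2h z]
      by linarith
    finally show ?thesis .
  qed
  thus "f \<in> class_A \<and> (\<exists>q. q holomorphic_on \<bbbD> \<and> (\<forall>z\<in>\<bbbD>. q z \<noteq> 0 \<and> f z = z * q z) \<and>
        (\<forall>z\<in>\<bbbD>. cmod (z * deriv q z / q z) \<le> 2 * (2 * cmod z / (1 - (cmod z)\<^sup>2)) + cmod z / (1 - cmod z)))"
    using f fac D by (intro conjI exI[of _ "\<lambda>z. p1 z * (p z * p2 z)"]) (auto intro!: holomorphic_intros)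
next
  fix \<rho> assume \<rho>: "0 \<le> \<rho>" "\<rho> < R"
  have "\<rho>\<^sup>2 < R\<^sup>2" using \<rho> by (intro power_strict_mono) auto
  hence less: "10 * \<rho> + 3 * \<rho>\<^sup>2 < 1" using assms \<rho> by linarith
  have pos: "0 < 1 - \<rho>" "0 < 1 + \<rho>" using \<rho> assms by auto
  have "2 * (2 * \<rho> / (1 - \<rho>\<^sup>2)) + \<rho> / (1 - \<rho>) = (5 * \<rho> + \<rho>\<^sup>2) / ((1 - \<rho>) * (1 + \<rho>))"
  proof -
    have "1 - \<rho>\<^sup>2 = (1 - \<rho>) * (1 + \<rho>)" by (simp add: power2_eq_square algebra_simps)
    thus ?thesis using pos by (simp add: divide_simps) (simp add: power2_eq_square algebra_simps)
  qed
  also have "\<dots> < 1 / 2"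
    using less pos by (simp add: pos_divide_less_eq) (simp add: power2_eq_square algebra_simps)
  finally show "2 * (2 * \<rho> / (1 - \<rho>\<^sup>2)) + \<rho> / (1 - \<rho>) < 1 / 2" .
qed (use assms in auto)

lemma class_G3_admissible:
  assumes "R < 1" "8 * R = 1 - R\<^sup>2"
  shows "radius_admissible parabolic_starlike class_G3 R"
proof (rule radius_admissibleI[where B = "\<lambda>\<rho>. 2 * (2 * \<rho> / (1 - \<rho>\<^sup>2))"])
  fix f assume "f \<in> class_G3"
  then obtain p where f: "f \<in> class_A" and p: "p \<in> class_P"
    and P: "remove_sings (\<lambda>z. f z / (z * p z)) \<in> class_P"
    unfolding class_G3_def by blast
  define p1 where "p1 = remove_sings (\<lambda>z. f z / (z * p z))"
  note fac = class_G3_factor[OF f p P, folded p1_def]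
  note P1 = P[folded p1_def]
  note D = class_PD[OF p] class_PD[OF P1]
  have "cmod (z * deriv (\<lambda>z. p z * p1 z) z / (p z * p1 z)) \<le> 2 * (2 * cmod z / (1 - (cmod z)\<^sup>2))"
    if z: "z \<in> \<bbbD>" for z
  proof -
    have "z * deriv (\<lambda>z. p z * p1 z) z / (p z * p1 z) = z * deriv p z / p z + z * deriv p1 z / p1 z"
      using z D by (simp add: log_deriv_mult)
    also have "cmod \<dots> \<le> cmod (z * deriv p z / p z) + cmod (z * deriv p1 z / p1 z)"
      by (rule norm_triangle_ineq)
    also have "\<dots> \<le> 2 * (2 * cmod z / (1 - (cmod z)\<^sup>2))"
      using class_P_log_deriv_bound[OF p z] class_P_log_deriv_bound[OF P1 z] by linarith
    finally show ?thesis .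
  qed
  thus "f \<in> class_A \<and> (\<exists>q. q holomorphic_on \<bbbD> \<and> (\<forall>z\<in>\<bbbD>. q z \<noteq> 0 \<and> f z = z * q z) \<and>
        (\<forall>z\<in>\<bbbD>. cmod (z * deriv q z / q z) \<le> 2 * (2 * cmod z / (1 - (cmod z)\<^sup>2))))"
    using f fac D by (intro conjI exI[of _ "\<lambda>z. p z * p1 z"]) (auto intro!: holomorphic_intros)
next
  fix \<rho> assume "0 \<le> \<rho>" "\<rho> < R"
  thus "2 * (2 * \<rho> / (1 - \<rho>\<^sup>2)) < 1 / 2"
    using assms by (intro quadratic_bound_less_half[of \<rho> R 2]) simp_all
qed (rule assms(1))

theorem theorem3p3:
  shows "is_class_radius parabolic_starlike class_G1 (sqrt 37 - 6) \<and>
    (\<exists>R. is_class_radius parabolic_starlike class_G2 R \<and> R \<ge> (2 * sqrt 7 - 5) / 3) \<and>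
    is_class_radius parabolic_starlike class_G3 (sqrt 17 - 4)"
proof (intro conjI)
  have sq: "(sqrt 37)\<^sup>2 = 37" "(sqrt 17)\<^sup>2 = 17" "(sqrt 7)\<^sup>2 = 7" by simp_all
  have "6 < sqrt 37" "sqrt 37 < 7" by (auto intro: real_less_rsqrt real_less_lsqrt)
  hence R1: "0 < sqrt 37 - 6" "sqrt 37 - 6 < 1" by simp_all
  have eq1: "12 * (sqrt 37 - 6) = 1 - (sqrt 37 - 6)\<^sup>2"
    unfolding power2_diff sq(1) by simp
  have "5 / 2 < sqrt 7" by (rule real_less_rsqrt) (simp add: power2_eq_square)
  moreover have "sqrt 7 < 4" by (rule real_less_lsqrt) auto
  ultimately have R2: "0 < (2 * sqrt 7 - 5) / 3" "(2 * sqrt 7 - 5) / 3 < 1" by simp_all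
  have eq2: "10 * ((2 * sqrt 7 - 5) / 3) + 3 * ((2 * sqrt 7 - 5) / 3)\<^sup>2 = 1"
    unfolding power_divide power2_diff power_mult_distrib sq(3) by (simp add: field_simps)
  have "4 < sqrt 17" "sqrt 17 < 5" by (auto intro: real_less_rsqrt real_less_lsqrt)
  hence R3: "0 < sqrt 17 - 4" "sqrt 17 - 4 < 1" by simp_all
  have eq3: "8 * (sqrt 17 - 4) = 1 - (sqrt 17 - 4)\<^sup>2"
    unfolding power2_diff sq(2) by simp
  have up1: "R' \<le> sqrt 37 - 6"
    if "R' \<in> {0<..<1}" "radius_admissible parabolic_starlike class_G1 R'" for R'
    using radius_upper_bound[OF that(2) extremal_class_G1 R1] eq1 that(1) by simp
  have up2: "R' \<le> sqrt 17 - 4"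
    if "R' \<in> {0<..<1}" "radius_admissible parabolic_starlike class_G2 R'" for R'
    using radius_upper_bound[OF that(2) extremal_class_G2 R3] eq3 that(1) by simp
  have up3: "R' \<le> sqrt 17 - 4"
    if "R' \<in> {0<..<1}" "radius_admissible parabolic_starlike class_G3 R'" for R'
    using radius_upper_bound[OF that(2) extremal_class_G3 R3] eq3 that(1) by simp
  show "is_class_radius parabolic_starlike class_G1 (sqrt 37 - 6)"
    unfolding is_class_radius_def
    using R1 class_G1_admissible[OF R1(2) eq1] up1 by simp
  show "\<exists>R. is_class_radius parabolic_starlike class_G2 R \<and> R \<ge> (2 * sqrt 7 - 5) / 3"
    by (rule is_class_radius_exists[OF class_G2_admissible[OF R2(2) eq2] R2(1) up2 R3(2) R2(2)])
  show "is_class_radius parabolic_starlike class_G3 (sqrt 17 - 4)"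
    unfolding is_class_radius_def
    using R3 class_G3_admissible[OF R3(2) eq3] up3 by simp
qed

end
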